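(* Let $d\ge2$, $\mathbf{n}=(n_1,\dots,n_d)\in\mathbb{N}^d$, and let $\mathcal{B}=\sum_{r=1}^{N_p}R_r^T\mathcal{B}_rR_r$, where $\mathcal{B}_r\in\mathcal{S}_{\mathbf{n}}^+$ for all $r=1,\dots,N_p$. Then the sequence of multipatch lumped matrices $\{\mathcal{P}_i\}_{i=1}^{n_1}$ constructed from $\mathcal{B}$, namely $\mathcal{P}_i=\sum_{r=1}^{N_p}R_r^T\mathcal{P}_{r,i}R_r$ where $\mathcal{P}_{r,i}$ is the $i$th block lumped matrix of $\mathcal{B}_r$, satisfies $$\mathcal{P}_1\succeq\mathcal{P}_2\succeq\dots\succeq\mathcal{P}_{n_1-1}\succeq\mathcal{P}_{n_1}=\mathcal{B}.$$
   Context: All matrices are real. For symmetric matrices $A,B$ of equal size, $A\succeq B$ (resp. $A\succ B$) means that $A-B$ is positive semidefinite (resp. positive definite). Sets $\mathcal{S}_{\mathbf{n}}$, $\mathcal{S}_{\mathbf{n}}^+$. For a positive integer $m$, $\mathcal{S}_m=\{B\in\mathbb{R}^{m\times m}: B=B^T,\ B\succeq 0\}$ and $\mathcal{S}_m^+=\{B\in\mathbb{R}^{m\times m}: B=B^T,\ B\succ 0\}$; for a vector $(m)$ of length one, $\mathcal{S}_{(m)}=\mathcal{S}_m$ and $\mathcal{S}_{(m)}^+=\mathcal{S}_m^+$. For $d\ge2$, $\mathbf{n}=(n_1,\dots,n_d)$ (positive integers), $n=\prod_{i=1}^d n_i$ and $r_1=\prod_{j=2}^d n_j$, partition a matrix $\mathcal{B}\in\mathbb{R}^{n\times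 n}$ into $n_1\times n_1$ blocks $B_{i,j}\in\mathbb{R}^{r_1\times r_1}$. Recursively, $\mathcal{S}_{(n_1,\dots,n_d)}=\{\mathcal{B}\in\mathcal{S}_n: B_{i,j}\in\mathcal{S}_{(n_2,\dots,n_d)}\ \forall i,j\}$ and $\mathcal{S}_{(n_1,\dots,n_d)}^+=\{\mathcal{B}\in\mathcal{S}_n^+: B_{i,j}\in\mathcal{S}_{(n_2,\dots,n_d)}\ \forall i,j\}$. Block lumping operator. For any block matrix partitioned into $n_1\times n_1$ blocks $B_{i,j}\in\mathbb{R}^{r_1\times r_1}$, $\mathcal{L}(\mathcal{B})$ is the block diagonal matrix $\operatorname{diag}(D_1,\dots,D_{n_1})$ with $D_i=\sum_{j=1}^{n_1}B_{i,j}$. Block lumped matrices of a single (patch) matrix $\mathcal{B}_r\in\mathcal{S}_{\mathbf{n}}^+$. For $i=1,\dots,n_1$ write $\mathcal{B}_r=\mathcal{D}_{i}+\mathcal{R}_{i}$, where $\mathcal{D}_{i}$ keeps the blocks with block indices $(k,l)$, $|k-l|<i$, and is zero elsewhere, and $\mathcal{R}_{i}$ is the remainder. Then $\mathcal{P}_{r,i}=\mathcal{D}_{i}+\mathcal{L}(\mathcal{R}_{i})$. Multipatch setting. $N_p$ is the number of patches and $R_r\in\mathbb{R}^{n\times N}$ ($N$ the global number of degrees of freedom) is the matrix mapping between the local degrees of freedom of the $r$th patch and the global ones. No other property of $R_r$ is imposed here. The same index $i$ is used on every patch. *)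

theory Defs
  imports Complex_Main "Jordan_Normal_Form.Matrix"
begin

definition symmetric_mat :: "real mat \<Rightarrow> bool" where
  "symmetric_mat A \<longleftrightarrow> square_mat A \<and> A\<^sup>T = A"

definition psd_mat :: "real mat \<Rightarrow> bool" where
  "psd_mat A \<longleftrightarrow> symmetric_mat A \<and> (\<forall>x \<in> carrier_vec (dim_row A). x \<bullet> (A *\<^sub>v x) \<ge> 0)"

definition pd_mat :: "real mat \<Rightarrow> bool" where
  "pd_mat A \<longleftrightarrow> symmetric_mat A \<and>
     (\<forall>x \<in> carrier_vec (dim_row A). x \<noteq> 0\<^sub>v (dim_row A) \<longrightarrow> x \<bullet> (A *\<^sub>v x) > 0)"

text \<open>
  Not to be confused with the order \<open>\<ge>\<close> that the matrix library puts on type \<open>mat\<close>, which is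
  entrywise. The relation carries the symmetry of both sides and the agreement of their sizes.
\<close>

definition loewner_ge :: "real mat \<Rightarrow> real mat \<Rightarrow> bool" (infix \<open>\<succeq>\<close> 50) where
  "A \<succeq> B \<longleftrightarrow> symmetric_mat A \<and> symmetric_mat B \<and> dim_row A = dim_row B \<and> psd_mat (A - B)"

text \<open>
  Block indices start at \<open>0\<close>: the block \<open>B\<^sub>i\<^sub>,\<^sub>j\<close> of the paper, with \<open>i, j\<close> in \<open>{1..n\<^sub>1}\<close>, is
  \<open>block r B (i - 1) (j - 1)\<close>, where \<open>r\<close> is the size of a block.
\<close>

definition block :: "nat \<Rightarrow> real mat \<Rightarrow> nat \<Rightarrow> nat \<Rightarrow> real mat" where
  "block r B i j = mat r r (\<lambda>(a, b). B $$ (i * r + a, j * r + b))"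

definition S_mats :: "nat \<Rightarrow> real mat set" where
  "S_mats m = {B \<in> carrier_mat m m. psd_mat B}"

definition S_plus_mats :: "nat \<Rightarrow> real mat set" where
  "S_plus_mats m = {B \<in> carrier_mat m m. pd_mat B}"

text \<open>The vector \<open>(n\<^sub>1, \<dots>, n\<^sub>d)\<close> is a list; the empty list is outside the scope of the definition.\<close>

fun S_nested :: "nat list \<Rightarrow> real mat set" where
  "S_nested [] = {}"
| "S_nested [m] = S_mats m"
| "S_nested (m # k # ks) =
     {B \<in> S_mats (prod_list (m # k # ks)).
        \<forall>i<m. \<forall>j<m. block (prod_list (k # ks)) B i j \<in> S_nested (k # ks)}"

text \<open>
  Not recursive: the whole matrix is positive definite, but its blocks are only required to lie
  in \<open>S_nested\<close>.
\<close>

fun S_plus_nested :: "nat list \<Rightarrow> real mat set" where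
  "S_plus_nested [] = {}"
| "S_plus_nested [m] = S_plus_mats m"
| "S_plus_nested (m # k # ks) =
     {B \<in> S_plus_mats (prod_list (m # k # ks)).
        \<forall>i<m. \<forall>j<m. block (prod_list (k # ks)) B i j \<in> S_nested (k # ks)}"

text \<open>
  Type \<open>mat\<close> is not an instance of \<open>comm_monoid_add\<close> (there is no zero of unspecified size), so
  \<open>\<Sum>\<close> does not apply to matrices.
\<close>

definition msum :: "nat \<Rightarrow> nat \<Rightarrow> ('i \<Rightarrow> real mat) \<Rightarrow> 'i set \<Rightarrow> real mat" where
  "msum m n F I = mat m n (\<lambda>(a, b). \<Sum>k\<in>I. F k $$ (a, b))"

text \<open>
  In the following definitions \<open>n1\<close> is the number of blocks per row and per column and \<open>r\<close> is the
  size of a block.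
\<close>

definition block_lump :: "nat \<Rightarrow> nat \<Rightarrow> real mat \<Rightarrow> real mat" where
  "block_lump n1 r B =
     diag_block_mat (map (\<lambda>i. msum r r (\<lambda>j. block r B i j) {..<n1}) [0..<n1])"

definition block_band :: "nat \<Rightarrow> nat \<Rightarrow> nat \<Rightarrow> real mat \<Rightarrow> real mat" where
  "block_band n1 r i B =
     mat (n1 * r) (n1 * r)
       (\<lambda>(a, b). if \<bar>int (a div r) - int (b div r)\<bar> < int i then B $$ (a, b) else 0)"

definition lumped_mat :: "nat list \<Rightarrow> nat \<Rightarrow> real mat \<Rightarrow> real mat" where
  "lumped_mat ns i B =
     (let n1 = hd ns; r = prod_list (tl ns); D = block_band n1 r i B; Rem = B - D
      in D + block_lump n1 r Rem)"

text \<open>Patches are numbered from \<open>1\<close> to \<open>Np\<close>; \<open>N\<close> is the global number of degrees of freedom.\<close>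

definition assemble :: "nat \<Rightarrow> nat \<Rightarrow> (nat \<Rightarrow> real mat) \<Rightarrow> (nat \<Rightarrow> real mat) \<Rightarrow> real mat" where
  "assemble N Np R A = msum N N (\<lambda>r. (R r)\<^sup>T * A r * R r) {1..Np}"

definition multipatch_lumped ::
  "nat list \<Rightarrow> nat \<Rightarrow> nat \<Rightarrow> (nat \<Rightarrow> real mat) \<Rightarrow> (nat \<Rightarrow> real mat) \<Rightarrow> nat \<Rightarrow> real mat" where
  "multipatch_lumped ns N Np R Bs i = assemble N Np R (\<lambda>r. lumped_mat ns i (Bs r))"

end

theory Submission
  imports Defs
begin

text \<open>
  On one patch, \<open>P\<^sub>i - P\<^sub>i\<^sub>+\<^sub>1 = L(E) - E\<close>, where \<open>E\<close> consists of the blocks of \<open>B\<close> at distance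
  exactly \<open>i\<close> from the block diagonal: these are the blocks that \<open>P\<^sub>i\<close> lumps and \<open>P\<^sub>i\<^sub>+\<^sub>1\<close> keeps, and
  lumping is additive. Since \<open>B\<close> and all its blocks are symmetric, \<open>E\<^sub>k\<^sub>l = E\<^sub>l\<^sub>k\<close>, so \<open>L(E) - E\<close>
  behaves like the Laplacian of a graph on the block indices whose edge weights are the positive
  semidefinite matrices \<open>E\<^sub>k\<^sub>l\<close>: splitting a vector \<open>x\<close> into block components,
  \<open>x\<^sup>T (L(E) - E) x = \<Sum>\<^sub>k\<^sub>,\<^sub>l (x\<^sub>k\<^sup>T E\<^sub>k\<^sub>l x\<^sub>k - x\<^sub>k\<^sup>T E\<^sub>k\<^sub>l x\<^sub>l)
    = 1/2 \<Sum>\<^sub>k\<^sub>,\<^sub>l (x\<^sub>k - x\<^sub>l)\<^sup>T E\<^sub>k\<^sub>l (x\<^sub>k - x\<^sub>l) \<ge> 0\<close>.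
  This is the lemma \<open>psd_block_lump_minus\<close>. The multipatch statement follows because assembling
  is linear and a sum of congruences \<open>R\<^sup>T A R\<close> preserves positive semidefiniteness. For
  \<open>i = n\<^sub>1\<close> the band contains all blocks, so there is nothing left to lump.
\<close>

section \<open>Quadratic forms\<close>

lemma symmetric_mat_iff:
  assumes "A \<in> carrier_mat n n"
  shows "symmetric_mat A \<longleftrightarrow> (\<forall>p<n. \<forall>q<n. A $$ (p, q) = A $$ (q, p))"
proof
  assume "symmetric_mat A"
  then have "A\<^sup>T = A" by (simp add: symmetric_mat_def)
  then show "\<forall>p<n. \<forall>q<n. A $$ (p, q) = A $$ (q, p)"
    using assms by (metis carrier_matD index_transpose_mat(1))
next
  assume "\<forall>p<n. \<forall>q<n. A $$ (p, q) = A $$ (q, p)"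
  then have "A\<^sup>T = A" using assms by (intro eq_matI) auto
  then show "symmetric_mat A" using assms by (simp add: symmetric_mat_def)
qed

lemma quadratic_form_eq_sum:
  fixes A :: "real mat"
  assumes "A \<in> carrier_mat n n" and "x \<in> carrier_vec n"
  shows "x \<bullet> (A *\<^sub>v x) = (\<Sum>p<n. \<Sum>q<n. x $ p * A $$ (p, q) * x $ q)"
  using assms
  by (auto simp: scalar_prod_def sum_distrib_left atLeast0LessThan mult.assoc intro!: sum.cong)

text \<open>
  Test vectors are replaced by functions on the indices, which can be restricted to blocks and
  subtracted without carrier conditions.
\<close>

lemma psd_mat_iff:
  assumes A: "A \<in> carrier_mat n n"
  shows "psd_mat A \<longleftrightarrow> symmetric_mat A \<and>
    (\<forall>x :: nat \<Rightarrow> real. 0 \<le> (\<Sum>p<n. \<Sum>q<n. x p * A $$ (p, q) * x q))"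
proof -
  have "(\<forall>x \<in> carrier_vec n. x \<bullet> (A *\<^sub>v x) \<ge> 0) \<longleftrightarrow>
    (\<forall>x :: nat \<Rightarrow> real. 0 \<le> (\<Sum>p<n. \<Sum>q<n. x p * A $$ (p, q) * x q))"
  proof (intro iffI allI ballI)
    fix x :: "nat \<Rightarrow> real"
    assume "\<forall>x \<in> carrier_vec n. x \<bullet> (A *\<^sub>v x) \<ge> 0"
    then have "vec n x \<bullet> (A *\<^sub>v vec n x) \<ge> 0" by simp
    then show "0 \<le> (\<Sum>p<n. \<Sum>q<n. x p * A $$ (p, q) * x q)"
      by (simp add: quadratic_form_eq_sum[OF A])
  next
    fix x :: "real vec"
    assume "\<forall>x :: nat \<Rightarrow> real. 0 \<le> (\<Sum>p<n. \<Sum>q<n. x p * A $$ (p, q) * x q)"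
      and "x \<in> carrier_vec n"
    then show "x \<bullet> (A *\<^sub>v x) \<ge> 0" by (simp add: quadratic_form_eq_sum[OF A])
  qed
  then show ?thesis using A by (simp add: psd_mat_def)
qed

lemma symmetric_mat_congruence:
  fixes A C :: "real mat"
  assumes C: "C \<in> carrier_mat n N" and A: "A \<in> carrier_mat n n" and "symmetric_mat A"
  shows "symmetric_mat (C\<^sup>T * A * C)"
proof -
  have "(C\<^sup>T * A * C)\<^sup>T = C\<^sup>T * (C\<^sup>T * A)\<^sup>T"
    by (rule transpose_mult) (use C A in auto)
  also have "(C\<^sup>T * A)\<^sup>T = A\<^sup>T * C"
    using transpose_mult[of "C\<^sup>T" N n A n] C A by simp
  also have "C\<^sup>T * (A\<^sup>T * C) = C\<^sup>T * A * C"
    using assms assoc_mult_mat[of "C\<^sup>T" N n A n C N] by (simp add: symmetric_mat_def)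
  finally show ?thesis using C by (simp add: symmetric_mat_def)
qed

lemma psd_mat_congruence:
  fixes A C :: "real mat"
  assumes C: "C \<in> carrier_mat n N" and A: "A \<in> carrier_mat n n" and psd: "psd_mat A"
  shows "psd_mat (C\<^sup>T * A * C)"
proof -
  have "x \<bullet> ((C\<^sup>T * A * C) *\<^sub>v x) \<ge> 0" if x: "x \<in> carrier_vec N" for x
  proof -
    have Cx: "C *\<^sub>v x \<in> carrier_vec n" using C x by simp
    have "(C\<^sup>T * A * C) *\<^sub>v x = C\<^sup>T *\<^sub>v (A *\<^sub>v (C *\<^sub>v x))"
      using assoc_mult_mat_vec[of "C\<^sup>T * A" N n C N x]
        assoc_mult_mat_vec[of "C\<^sup>T" N n A n "C *\<^sub>v x"] C A x Cx by simp
    then have "x \<bullet> ((C\<^sup>T * A * C) *\<^sub>v x) = (C\<^sup>T *\<^sub>v (A *\<^sub>v (C *\<^sub>v x))) \<bullet> x"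
      using C A x Cx by (simp add: comm_scalar_prod[of x N])
    also have "\<dots> = (A *\<^sub>v (C *\<^sub>v x)) \<bullet> (C *\<^sub>v x)"
      using transpose_vec_mult_scalar[OF C x, of "A *\<^sub>v (C *\<^sub>v x)"] A Cx by simp
    also have "\<dots> = (C *\<^sub>v x) \<bullet> (A *\<^sub>v (C *\<^sub>v x))"
      using A Cx by (intro comm_scalar_prod[of _ n]) auto
    also have "\<dots> \<ge> 0" using psd A Cx by (auto simp: psd_mat_def)
    finally show ?thesis .
  qed
  then show ?thesis
    using symmetric_mat_congruence[OF C A] psd C by (simp add: psd_mat_def)
qed

lemma symmetric_mat_msum:
  assumes "\<And>k. k \<in> I \<Longrightarrow> F k \<in> carrier_mat n n" "\<And>k. k \<in> I \<Longrightarrow> symmetric_mat (F k)"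
  shows "symmetric_mat (msum n n F I)"
proof -
  have "F k $$ (p, q) = F k $$ (q, p)" if "k \<in> I" "p < n" "q < n" for k p q
    using assms that symmetric_mat_iff by blast
  then show ?thesis
    by (subst symmetric_mat_iff[of _ n]) (auto simp: msum_def intro!: sum.cong)
qed

lemma psd_mat_msum:
  assumes F: "\<And>k. k \<in> I \<Longrightarrow> F k \<in> carrier_mat n n" and psd: "\<And>k. k \<in> I \<Longrightarrow> psd_mat (F k)"
  shows "psd_mat (msum n n F I)"
proof -
  have "0 \<le> (\<Sum>p<n. \<Sum>q<n. x p * msum n n F I $$ (p, q) * x q)" for x :: "nat \<Rightarrow> real"
  proof -
    have "(\<Sum>p<n. \<Sum>q<n. x p * msum n n F I $$ (p, q) * x q)
        = (\<Sum>p<n. \<Sum>q<n. \<Sum>k\<in>I. x p * F k $$ (p, q) * x q)"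
      by (simp add: msum_def sum_distrib_left sum_distrib_right)
    also have "\<dots> = (\<Sum>k\<in>I. \<Sum>p<n. \<Sum>q<n. x p * F k $$ (p, q) * x q)"
      by (simp add: sum.swap[of _ I])
    also have "\<dots> \<ge> 0"
      by (rule sum_nonneg) (use psd_mat_iff[OF F] psd in blast)
    finally show ?thesis .
  qed
  moreover have "symmetric_mat (msum n n F I)"
    using F psd by (intro symmetric_mat_msum) (auto simp: psd_mat_def)
  ultimately show ?thesis
    by (subst psd_mat_iff[of _ n]) (auto simp: msum_def)
qed

section \<open>Block indices\<close>

text \<open>
  Banding is defined by \<open>div\<close> on indices, lumping by a list of diagonal blocks. Writing every
  index as \<open>k * r + a\<close> with \<open>a < r\<close> gives the entries of both in a common form.
\<close>

lemma block_index_less: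
  assumes "k < m" "a < r"
  shows "k * r + a < m * (r :: nat)"
proof -
  have "k * r + a < Suc k * r" using assms by simp
  also have "\<dots> \<le> m * r" using assms by (intro mult_right_mono) auto
  finally show ?thesis .
qed

lemma block_index_cases:
  assumes "p < m * (r :: nat)"
  obtains k a where "k < m" "a < r" "p = k * r + a"
proof
  have "r > 0" using assms by (cases r) auto
  then show "p div r < m" "p mod r < r" using assms by (auto simp: less_mult_imp_div_less)
  show "p = p div r * r + p mod r" by simp
qed

lemma sum_block_index:
  fixes f :: "nat \<Rightarrow> 'a :: comm_monoid_add"
  shows "(\<Sum>p<m * r. f p) = (\<Sum>k<m. \<Sum>a<r. f (k * r + a))"
proof -
  have "sum f {k * r..<k * r + r} = (\<Sum>a<r. f (k * r + a))" for k
    using sum.shift_bounds_nat_ivl[of f 0 "k * r" r]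
    by (simp add: atLeast0LessThan add.commute)
  then show ?thesis by (simp add: sum.nat_group[symmetric])
qed

lemma eq_mat_blockI:
  assumes "A \<in> carrier_mat (m * r) (m * r)" "B \<in> carrier_mat (m * r) (m * r)"
    and "\<And>k l a b. \<lbrakk>k < m; l < m; a < r; b < r\<rbrakk> \<Longrightarrow>
           A $$ (k * r + a, l * r + b) = B $$ (k * r + a, l * r + b)"
  shows "A = B"
  using assms by (intro eq_matI) (auto elim!: block_index_cases)

lemma symmetric_mat_blockI:
  assumes "A \<in> carrier_mat (m * r) (m * r)"
    and "\<And>k l a b. \<lbrakk>k < m; l < m; a < r; b < r\<rbrakk> \<Longrightarrow>
           A $$ (k * r + a, l * r + b) = A $$ (l * r + b, k * r + a)"
  shows "symmetric_mat A"
  using assms by (subst symmetric_mat_iff[of _ "m * r"]) (auto elim!: block_index_cases)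

lemma dim_diag_block_mat_const:
  assumes "\<forall>A \<in> set As. A \<in> carrier_mat r r"
  shows "diag_block_mat As \<in> carrier_mat (length As * r) (length As * r)"
  using assms by (induction As) (auto simp: Let_def)

lemma diag_block_mat_block_index:
  assumes "\<forall>A \<in> set As. A \<in> carrier_mat r r" "k < length As" "l < length As" "a < r" "b < r"
  shows "diag_block_mat As $$ (k * r + a, l * r + b) = (if k = l then (As ! k) $$ (a, b) else 0)"
  using assms
proof (induction As arbitrary: k l)
  case Nil
  then show ?case by simp
next
  case (Cons A As)
  have dims: "dim_row A = r" "dim_col A = r"
    "dim_row (diag_block_mat As) = length As * r" "dim_col (diag_block_mat As) = length As * r"
    using Cons.prems dim_diag_block_mat_const[of As r] by auto
  have "Suc k' * r + a < r + length As * r" if "k' < length As" "a < r" for k' a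
    using block_index_less[of k' "length As" a r] that by simp
  moreover have "diag_block_mat As $$ (k' * r + a, l' * r + b)
      = (if k' = l' then (As ! k') $$ (a, b) else 0)"
    if "k' < length As" "l' < length As" for k' l'
    using Cons.IH[of k' l'] Cons.prems that by simp
  ultimately show ?case
    using Cons.prems dims
    by (cases k; cases l) (auto simp: Let_def)
qed

lemma block_lump_carrier [simp]:
  "block_lump m r E \<in> carrier_mat (m * r) (m * r)"
  using dim_diag_block_mat_const[of "map (\<lambda>i. msum r r (\<lambda>j. block r E i j) {..<m}) [0..<m]" r]
  by (auto simp: block_lump_def msum_def)

lemma dim_block_lump [simp]:
  "dim_row (block_lump m r E) = m * r" "dim_col (block_lump m r E) = m * r"
  using block_lump_carrier by blast+

lemma block_lump_index:
  assumes "k < m" "l < m" "a < r" "b < r"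
  shows "block_lump m r E $$ (k * r + a, l * r + b)
    = (if k = l then \<Sum>j<m. E $$ (k * r + a, j * r + b) else 0)"
  unfolding block_lump_def
  by (subst diag_block_mat_block_index) (use assms in \<open>auto simp: msum_def block_def\<close>)

lemma block_band_carrier [simp]:
  "block_band m r i B \<in> carrier_mat (m * r) (m * r)"
  by (simp add: block_band_def)

lemma dim_block_band [simp]:
  "dim_row (block_band m r i B) = m * r" "dim_col (block_band m r i B) = m * r"
  by (simp_all add: block_band_def)

lemma block_band_index:
  assumes "k < m" "l < m" "a < r" "b < r"
  shows "block_band m r i B $$ (k * r + a, l * r + b)
    = (if \<bar>int k - int l\<bar> < int i then B $$ (k * r + a, l * r + b) else 0)"
  using assms block_index_less[of k m a r] block_index_less[of l m b r]
  by (simp add: block_band_def)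

lemma block_band_full:
  assumes "B \<in> carrier_mat (m * r) (m * r)"
  shows "block_band m r m B = B"
  by (rule eq_mat_blockI[of _ m r]) (use assms in \<open>auto simp: block_band_index\<close>)

text \<open>
  Blocks at transposed positions agree: \<open>B\<^sub>l\<^sub>k = B\<^sub>k\<^sub>l\<^sup>T\<close> because \<open>B\<close> is symmetric, and \<open>B\<^sub>k\<^sub>l\<^sup>T = B\<^sub>k\<^sub>l\<close>
  because the block is.
\<close>

lemma block_entries_sym:
  assumes E: "E \<in> carrier_mat (m * r) (m * r)" "symmetric_mat E"
    and blocks: "\<And>k l. \<lbrakk>k < m; l < m\<rbrakk> \<Longrightarrow> symmetric_mat (block r E k l)"
    and "k < m" "l < m" "a < r" "b < r"
  shows block_entries_transpose: "E $$ (k * r + a, l * r + b) = E $$ (k * r + b, l * r + a)"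
    and block_entries_swap: "E $$ (k * r + a, l * r + b) = E $$ (l * r + a, k * r + b)"
proof -
  have "block r E k l $$ (a, b) = block r E k l $$ (b, a)"
    using symmetric_mat_iff[of "block r E k l" r] blocks assms by (simp add: block_def)
  then show *: "E $$ (k * r + a, l * r + b) = E $$ (k * r + b, l * r + a)"
    using assms by (simp add: block_def)
  have "E $$ (k * r + b, l * r + a) = E $$ (l * r + a, k * r + b)"
    using symmetric_mat_iff[OF E(1)] E(2) assms block_index_less by simp
  with * show "E $$ (k * r + a, l * r + b) = E $$ (l * r + a, k * r + b)" by simp
qed

section \<open>Lumping increases the quadratic form\<close>

lemma symmetric_mat_block_lump:
  assumes "E \<in> carrier_mat (m * r) (m * r)" "symmetric_mat E"
    and "\<And>k l. \<lbrakk>k < m; l < m\<rbrakk> \<Longrightarrow> symmetric_mat (block r E k l)"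
  shows "symmetric_mat (block_lump m r E)"
  by (rule symmetric_mat_blockI[OF block_lump_carrier])
    (use block_entries_transpose[OF assms] in \<open>auto simp: block_lump_index intro!: sum.cong\<close>)

lemma symmetric_mat_minus:
  assumes "A \<in> carrier_mat n n" "B \<in> carrier_mat n n" "symmetric_mat A" "symmetric_mat B"
  shows "symmetric_mat (A - B)"
  using assms symmetric_mat_iff[of A n] symmetric_mat_iff[of B n]
  by (subst symmetric_mat_iff[of _ n]) auto

lemma symmetric_mat_add:
  assumes "A \<in> carrier_mat n n" "B \<in> carrier_mat n n" "symmetric_mat A" "symmetric_mat B"
  shows "symmetric_mat (A + B)"
  using assms symmetric_mat_iff[of A n] symmetric_mat_iff[of B n]
  by (subst symmetric_mat_iff[of _ n]) auto

text \<open>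
  The block version of the positive semidefiniteness of a graph Laplacian, with the matrices
  \<open>E\<^sub>k\<^sub>l = E\<^sub>l\<^sub>k\<close> as edge weights.
\<close>

lemma psd_block_lump_minus:
  assumes E: "E \<in> carrier_mat (m * r) (m * r)" "symmetric_mat E"
    and psd: "\<And>k l. \<lbrakk>k < m; l < m\<rbrakk> \<Longrightarrow> psd_mat (block r E k l)"
  shows "psd_mat (block_lump m r E - E)"
proof -
  have sym: "\<And>k l. \<lbrakk>k < m; l < m\<rbrakk> \<Longrightarrow> symmetric_mat (block r E k l)"
    using psd by (auto simp: psd_mat_def)
  have "0 \<le> (\<Sum>p<m * r. \<Sum>q<m * r. x p * (block_lump m r E - E) $$ (p, q) * x q)"
    for x :: "nat \<Rightarrow> real"
  proof -
    \<comment> \<open>the bilinear form of the block \<open>E\<^sub>k\<^sub>l\<close>, evaluated at two block components of a vector\<close>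
    define Q where "Q k l u v = (\<Sum>a<r. \<Sum>b<r. u a * E $$ (k * r + a, l * r + b) * v b)"
      for k l and u v :: "nat \<Rightarrow> real"
    define X where "X k a = x (k * r + a)" for k a
    have Q_swap: "Q k l u v = Q l k u v" if "k < m" "l < m" for k l u v
      unfolding Q_def
      by (intro sum.cong refl) (use block_entries_swap[OF E sym] that in auto)
    have Q_nonneg: "Q k l u u \<ge> 0" if "k < m" "l < m" for k l u
    proof -
      have "0 \<le> (\<Sum>a<r. \<Sum>b<r. u a * block r E k l $$ (a, b) * u b)"
        using psd_mat_iff[of "block r E k l" r] psd[OF that] by (simp add: block_def)
      then show ?thesis by (simp add: Q_def block_def)
    qed
    have Q_diff: "Q k l (\<lambda>a. u a - v a) (\<lambda>a. u a - v a)
        = (Q k l u u - Q k l u v) + (Q k l v v - Q k l v u)" for k l u v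
      by (simp add: Q_def algebra_simps sum.distrib sum_subtractf)
    let ?d = "\<lambda>k l. Q k l (X k) (X k) - Q k l (X k) (X l)"
    have "(\<Sum>p<m * r. \<Sum>q<m * r. x p * (block_lump m r E - E) $$ (p, q) * x q)
        = (\<Sum>k<m. \<Sum>a<r. \<Sum>l<m. \<Sum>b<r.
             X k a * (block_lump m r E - E) $$ (k * r + a, l * r + b) * X l b)"
      by (simp add: sum_block_index X_def)
    also have "\<dots> = (\<Sum>k<m. \<Sum>a<r. \<Sum>l<m. \<Sum>b<r.
             (if k = l then X k a * (\<Sum>j<m. E $$ (k * r + a, j * r + b)) * X k b else 0)
             - X k a * E $$ (k * r + a, l * r + b) * X l b)"
      using E(1) by (intro sum.cong refl)
        (auto simp: block_lump_index block_index_less right_diff_distrib left_diff_distrib)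
    also have "\<dots> = (\<Sum>k<m. (\<Sum>a<r. \<Sum>b<r. X k a * (\<Sum>j<m. E $$ (k * r + a, j * r + b)) * X k b)
             - (\<Sum>l<m. Q k l (X k) (X l)))"
    proof (intro sum.cong refl)
      fix k assume "k \<in> {..<m}"
      then have "(\<Sum>l<m. \<Sum>b<r. if k = l then f b else 0) = (\<Sum>b<r. f b)" for f :: "nat \<Rightarrow> real"
        by (subst sum.swap) simp
      moreover have "(\<Sum>a<r. \<Sum>l<m. \<Sum>b<r. X k a * E $$ (k * r + a, l * r + b) * X l b)
          = (\<Sum>l<m. Q k l (X k) (X l))"
        unfolding Q_def by (rule sum.swap)
      ultimately show "(\<Sum>a<r. \<Sum>l<m. \<Sum>b<r.
             (if k = l then X k a * (\<Sum>j<m. E $$ (k * r + a, j * r + b)) * X k b else 0)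
             - X k a * E $$ (k * r + a, l * r + b) * X l b)
        = (\<Sum>a<r. \<Sum>b<r. X k a * (\<Sum>j<m. E $$ (k * r + a, j * r + b)) * X k b)
             - (\<Sum>l<m. Q k l (X k) (X l))"
        by (simp add: sum_subtractf)
    qed
    also have "\<dots> = (\<Sum>k<m. \<Sum>l<m. ?d k l)"
    proof -
      have "(\<Sum>a<r. \<Sum>b<r. X k a * (\<Sum>j<m. E $$ (k * r + a, j * r + b)) * X k b)
          = (\<Sum>j<m. Q k j (X k) (X k))" for k
        by (simp add: Q_def sum_distrib_left sum_distrib_right sum.swap[of _ "{..<m}"])
      then show ?thesis by (simp add: sum_subtractf)
    qed
    finally have form: "(\<Sum>p<m * r. \<Sum>q<m * r. x p * (block_lump m r E - E) $$ (p, q) * x q)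
        = (\<Sum>k<m. \<Sum>l<m. ?d k l)" .
    \<comment> \<open>averaging the double sum with its transpose completes the square in each pair \<open>k, l\<close>\<close>
    have "(\<Sum>k<m. \<Sum>l<m. ?d k l) + (\<Sum>k<m. \<Sum>l<m. ?d k l)
        = (\<Sum>k<m. \<Sum>l<m. ?d k l) + (\<Sum>k<m. \<Sum>l<m. ?d l k)"
      using sum.swap[of ?d "{..<m}" "{..<m}"] by simp
    also have "\<dots> = (\<Sum>k<m. \<Sum>l<m. ?d k l + ?d l k)"
      by (simp add: sum.distrib)
    also have "\<dots> = (\<Sum>k<m. \<Sum>l<m. Q k l (\<lambda>a. X k a - X l a) (\<lambda>a. X k a - X l a))"
      by (intro sum.cong refl) (simp add: Q_diff Q_swap)
    also have "\<dots> \<ge> 0"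
      by (intro sum_nonneg Q_nonneg) auto
    finally show ?thesis unfolding form by simp
  qed
  moreover have "symmetric_mat (block_lump m r E - E)"
    using symmetric_mat_block_lump[OF E sym] E
    by (intro symmetric_mat_minus[of _ "m * r"]) auto
  ultimately show ?thesis
    using E(1) by (subst psd_mat_iff[of _ "m * r"]) auto
qed

section \<open>The lumped matrices of one patch\<close>

lemma symmetric_mat_block_band:
  assumes "B \<in> carrier_mat (m * r) (m * r)" "symmetric_mat B"
  shows "symmetric_mat (block_band m r i B)"
proof (rule symmetric_mat_blockI[OF block_band_carrier])
  fix k l a b assume kl: "k < m" "l < m" "a < r" "b < r"
  then have "B $$ (k * r + a, l * r + b) = B $$ (l * r + b, k * r + a)"
    using symmetric_mat_iff[OF assms(1)] assms(2) block_index_less by simp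
  then show "block_band m r i B $$ (k * r + a, l * r + b) = block_band m r i B $$ (l * r + b, k * r + a)"
    using kl by (simp add: block_band_index abs_minus_commute)
qed

lemma block_minus:
  assumes "A \<in> carrier_mat (m * r) (m * r)" "B \<in> carrier_mat (m * r) (m * r)" "k < m" "l < m"
  shows "block r (A - B) k l = block r A k l - block r B k l"
  using assms by (intro eq_matI) (auto simp: block_def block_index_less)

lemma block_block_band:
  assumes "k < m" "l < m"
  shows "block r (block_band m r i B) k l
    = (if \<bar>int k - int l\<bar> < int i then block r B k l else 0\<^sub>m r r)"
  using assms by (intro eq_matI) (auto simp: block_def block_band_index)

lemma psd_mat_zero: "psd_mat (0\<^sub>m r r)"
  by (subst psd_mat_iff[of _ r]) (auto simp: symmetric_mat_def)

text \<open>
  Lumping sees only the outermost level of blocks. A patch matrix in \<open>S_plus_nested\<close> fits here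
  because every member of \<open>S_nested\<close>, at whatever depth, is positive semidefinite.
\<close>

locale psd_block_mat =
  fixes m r :: nat and B :: "real mat"
  assumes carrier: "B \<in> carrier_mat (m * r) (m * r)"
    and symmetric: "symmetric_mat B"
    and psd_blocks: "\<And>k l. \<lbrakk>k < m; l < m\<rbrakk> \<Longrightarrow> psd_mat (block r B k l)"
begin

definition lumped :: "nat \<Rightarrow> real mat" where
  "lumped i = block_band m r i B + block_lump m r (B - block_band m r i B)"

lemma lumped_carrier: "lumped i \<in> carrier_mat (m * r) (m * r)"
  by (simp add: lumped_def)

lemma symmetric_lumped: "symmetric_mat (lumped i)"
proof -
  have "symmetric_mat (block r (B - block_band m r i B) k l)" if "k < m" "l < m" for k l
  proof -
    have B: "block r B k l \<in> carrier_mat r r" "symmetric_mat (block r B k l)"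
      and Z: "symmetric_mat (0\<^sub>m r r)"
      using psd_blocks[OF that] psd_mat_zero[of r] by (auto simp: psd_mat_def block_def)
    then show ?thesis
      unfolding block_minus[OF carrier block_band_carrier that] block_block_band[OF that]
      by (intro symmetric_mat_minus[of _ r]) auto
  qed
  then have "symmetric_mat (block_lump m r (B - block_band m r i B))"
    using carrier symmetric
    by (intro symmetric_mat_block_lump symmetric_mat_minus[of _ "m * r"] symmetric_mat_block_band
        minus_carrier_mat) auto
  then show ?thesis
    unfolding lumped_def using carrier symmetric
    by (intro symmetric_mat_add[of _ "m * r"] symmetric_mat_block_band) auto
qed

lemma psd_lumped_diff: "psd_mat (lumped i - lumped (Suc i))"
proof -
  \<comment> \<open>the blocks at distance exactly \<open>i\<close>, which are lumped at stage \<open>i\<close> and kept at stage \<open>i + 1\<close>\<close>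
  let ?E = "block_band m r (Suc i) B - block_band m r i B"
  have "lumped i - lumped (Suc i) = block_lump m r ?E - ?E"
  proof (rule eq_mat_blockI[of _ m r])
    fix k l a b assume "k < m" "l < m" "a < r" "b < r"
    then show "(lumped i - lumped (Suc i)) $$ (k * r + a, l * r + b)
        = (block_lump m r ?E - ?E) $$ (k * r + a, l * r + b)"
      using carrier
      by (simp add: lumped_def block_lump_index block_index_less sum_subtractf)
  qed (auto intro!: minus_carrier_mat lumped_carrier)
  moreover have "psd_mat (block_lump m r ?E - ?E)"
  proof (rule psd_block_lump_minus)
    fix k l assume kl: "k < m" "l < m"
    have "block r ?E k l = (if \<bar>int k - int l\<bar> = int i then block r B k l else 0\<^sub>m r r)"
      unfolding block_minus[OF block_band_carrier block_band_carrier kl] block_block_band[OF kl]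
      by (auto simp: block_def)
    then show "psd_mat (block r ?E k l)"
      using psd_blocks[OF kl] psd_mat_zero by simp
  qed (use carrier symmetric in
      \<open>auto intro!: symmetric_mat_minus[of _ "m * r"] symmetric_mat_block_band minus_carrier_mat\<close>)
  ultimately show ?thesis by simp
qed

lemma lumped_last: "lumped m = B"
proof -
  have "block_lump m r (B - B) = 0\<^sub>m (m * r) (m * r)"
    using carrier
    by (intro eq_mat_blockI[of _ m r]) (auto simp: block_lump_index block_index_less)
  then show ?thesis using carrier by (simp add: lumped_def block_band_full)
qed

end

lemma S_nested_psd:
  assumes "A \<in> S_nested ns"
  shows "psd_mat A"
  using assms by (cases ns rule: S_nested.cases) (auto simp: S_mats_def)

lemma S_plus_nested_psd_block_mat:
  assumes "A \<in> S_plus_nested (m # k # ks)"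
  shows "psd_block_mat m (prod_list (k # ks)) A"
  using assms S_nested_psd[of _ "k # ks"]
  by unfold_locales (auto simp: S_plus_mats_def pd_mat_def)

section \<open>Assembling the patches\<close>

lemma loewner_ge_assemble:
  assumes R: "\<And>r. r \<in> {1..Np} \<Longrightarrow> R r \<in> carrier_mat n N"
    and A: "\<And>r. r \<in> {1..Np} \<Longrightarrow> A r \<in> carrier_mat n n"
    and A': "\<And>r. r \<in> {1..Np} \<Longrightarrow> A' r \<in> carrier_mat n n"
    and ge: "\<And>r. r \<in> {1..Np} \<Longrightarrow> A r \<succeq> A' r"
  shows "assemble N Np R A \<succeq> assemble N Np R A'"
proof -
  have sym: "symmetric_mat (assemble N Np R C)"
    if "\<And>r. r \<in> {1..Np} \<Longrightarrow> C r \<in> carrier_mat n n" "\<And>r. r \<in> {1..Np} \<Longrightarrow> symmetric_mat (C r)"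
    for C
    unfolding assemble_def
  proof (rule symmetric_mat_msum)
    fix r assume r: "r \<in> {1..Np}"
    show "(R r)\<^sup>T * C r * R r \<in> carrier_mat N N" using R[OF r] by (intro carrier_matI) simp_all
    show "symmetric_mat ((R r)\<^sup>T * C r * R r)"
      by (rule symmetric_mat_congruence[OF R[OF r]]) (use that r in auto)
  qed
  have "((R r)\<^sup>T * (A r - A' r) * R r) $$ (p, q)
      = ((R r)\<^sup>T * A r * R r) $$ (p, q) - ((R r)\<^sup>T * A' r * R r) $$ (p, q)"
    if "r \<in> {1..Np}" "p < N" "q < N" for r p q
  proof -
    have "(R r)\<^sup>T * (A r - A' r) * R r = (R r)\<^sup>T * A r * R r - (R r)\<^sup>T * A' r * R r"
      using R[OF that(1)] A[OF that(1)] A'[OF that(1)]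
      by (simp add: mult_minus_distrib_mat[of _ N n] minus_mult_distrib_mat[of _ N n])
    then show ?thesis using R[OF that(1)] that by simp
  qed
  then have "assemble N Np R A - assemble N Np R A' = assemble N Np R (\<lambda>r. A r - A' r)"
    by (intro eq_matI)
      (auto simp: assemble_def msum_def sum_subtractf[symmetric] intro!: sum.cong)
  moreover have "psd_mat (assemble N Np R (\<lambda>r. A r - A' r))"
    unfolding assemble_def
  proof (rule psd_mat_msum)
    fix r assume r: "r \<in> {1..Np}"
    show "(R r)\<^sup>T * (A r - A' r) * R r \<in> carrier_mat N N" using R[OF r] by (intro carrier_matI) simp_all
    show "psd_mat ((R r)\<^sup>T * (A r - A' r) * R r)"
      by (rule psd_mat_congruence[OF R[OF r]]) (use A A' ge r in \<open>auto simp: loewner_ge_def intro!: minus_carrier_mat\<close>)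
  qed
  ultimately show ?thesis
    using sym[of A] sym[of A'] A A' ge
    by (auto simp: loewner_ge_def) (auto simp: assemble_def msum_def)
qed

lemma assemble_cong:
  assumes "\<And>r. r \<in> {1..Np} \<Longrightarrow> A r = A' r"
  shows "assemble N Np R A = assemble N Np R A'"
  using assms unfolding assemble_def msum_def by (intro cong_mat) (auto intro!: sum.cong)

theorem lemma3p22:
  fixes d N Np :: nat
    and ns :: "nat list"
    and R Bs :: "nat \<Rightarrow> real mat"
    and B :: "real mat"
  assumes "d \<ge> 2"
    and "length ns = d"
    and "\<forall>m \<in> set ns. m > 0"
    and "\<forall>r \<in> {1..Np}. R r \<in> carrier_mat (prod_list ns) N"
    and "\<forall>r \<in> {1..Np}. Bs r \<in> S_plus_nested ns"
    and "B = assemble N Np R Bs"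
  shows "(\<forall>i \<in> {1..<hd ns}. multipatch_lumped ns N Np R Bs i \<succeq> multipatch_lumped ns N Np R Bs (i + 1))
       \<and> multipatch_lumped ns N Np R Bs (hd ns) = B"
proof -
  obtain m k ks where ns: "ns = m # k # ks"
    using assms(1,2) by (cases ns rule: S_nested.cases) auto
  let ?s = "prod_list (k # ks)"
  have patch: "psd_block_mat m ?s (Bs r)" if "r \<in> {1..Np}" for r
    using assms(5) that unfolding ns by (intro S_plus_nested_psd_block_mat) auto
  have lumped: "lumped_mat ns i (Bs r) = psd_block_mat.lumped m ?s (Bs r) i"
    if "r \<in> {1..Np}" for r i
    unfolding psd_block_mat.lumped_def[OF patch[OF that]] lumped_mat_def ns by (simp add: Let_def)
  have lumped_carrier: "lumped_mat ns i (Bs r) \<in> carrier_mat (prod_list ns) (prod_list ns)"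
    if "r \<in> {1..Np}" for r i
    using psd_block_mat.lumped_carrier[OF patch[OF that], of i] lumped[OF that] by (simp add: ns)
  have ge: "lumped_mat ns i (Bs r) \<succeq> lumped_mat ns (i + 1) (Bs r)" if r: "r \<in> {1..Np}" for r i
    using lumped[OF r] psd_block_mat.psd_lumped_diff[OF patch[OF r], of i]
      psd_block_mat.symmetric_lumped[OF patch[OF r]]
      lumped_carrier[OF r, THEN carrier_matD(1)]
    unfolding loewner_ge_def by simp
  have "multipatch_lumped ns N Np R Bs i \<succeq> multipatch_lumped ns N Np R Bs (i + 1)" for i
    unfolding multipatch_lumped_def
    by (rule loewner_ge_assemble[of Np R "prod_list ns"])
      (use assms(4) lumped_carrier ge in auto)
  moreover have "multipatch_lumped ns N Np R Bs (hd ns) = B"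
    unfolding multipatch_lumped_def assms(6)
    by (rule assemble_cong) (use lumped psd_block_mat.lumped_last[OF patch] in \<open>simp add: ns\<close>)
  ultimately show ?thesis by simp
qed

end
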